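(* Let $G_i$, $i\in I$, be a family of centralizers of connected functions (i.e. for each $i$ there is a connected function $f_i:X_i\to X_i$ with $G_i\cong\mathrm{Aut}(f_i)$), and let $\Sigma_i=\Sigma_{C_i}$ be the symmetric groups on respective sets $C_i$. Then the group $$G:=\prod_{i\in I}G_i\wr\Sigma_i$$ is a function centralizer, i.e. there exist a set $X$ and a function $f:X\to X$ with $G\cong\mathrm{Aut}(f)$.
   Context: All sets are non-empty. $\Sigma_X$ is the group of all permutations of $X$. For $f:X\to X$, $\mathrm{Aut}(f)=\{\sigma\in\Sigma_X:\sigma\circ f=f\circ\sigma\}$. A function $f:X\to X$ is connected if for all $x,y\in X$ there are non-negative integers $m,n$ with $f^m(x)=f^n(y)$. For a group $G$ and a set $C$, $G\wr\Sigma_C$ is the (unrestricted) wreath product $G^C\rtimes\Sigma_C$ with $\Sigma_C$ permuting the coordinates. *)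

theory Defs
  imports "HOL-Algebra.Bij" "HOL-Algebra.Product_Groups"
begin

text \<open>
  Throughout, a function from \<open>A\<close> to \<open>A\<close> is an \<open>f\<close> with \<open>f \<in> A \<rightarrow> A\<close>; its values outside \<open>A\<close>
  are irrelevant. The group of all permutations of \<open>A\<close> is \<^const>\<open>BijGroup\<close>, whose elements are
  extensional on \<open>A\<close>.
\<close>

definition fun_centralizer :: "'a set \<Rightarrow> ('a \<Rightarrow> 'a) \<Rightarrow> ('a \<Rightarrow> 'a) monoid" where
  "fun_centralizer A f =
     BijGroup A \<lparr>carrier := {\<sigma> \<in> carrier (BijGroup A). compose A \<sigma> f = compose A f \<sigma>}\<rparr>"

definition connected_fun :: "'a set \<Rightarrow> ('a \<Rightarrow> 'a) \<Rightarrow> bool" where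
  "connected_fun A f \<longleftrightarrow>
     f \<in> A \<rightarrow> A \<and> (\<forall>x\<in>A. \<forall>y\<in>A. \<exists>m n :: nat. (f ^^ m) x = (f ^^ n) y)"

text \<open>External semidirect product for a left action \<open>\<phi>\<close> of \<open>H\<close> on \<open>N\<close> by automorphisms.\<close>

definition semidirect_product ::
    "('n, 'k) monoid_scheme \<Rightarrow> ('h, 'l) monoid_scheme \<Rightarrow> ('h \<Rightarrow> 'n \<Rightarrow> 'n) \<Rightarrow> ('n \<times> 'h) monoid" where
  "semidirect_product N H \<phi> =
     \<lparr>carrier = carrier N \<times> carrier H,
      mult = (\<lambda>(a, \<sigma>) (b, \<tau>). (a \<otimes>\<^bsub>N\<^esub> \<phi> \<sigma> b, \<sigma> \<otimes>\<^bsub>H\<^esub> \<tau>)),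
      one = (\<one>\<^bsub>N\<^esub>, \<one>\<^bsub>H\<^esub>)\<rparr>"

text \<open>
  The unrestricted wreath product of \<open>G\<close> with the full symmetric group on \<open>C\<close>. A permutation moves
  the entry at \<open>c\<close> to position \<open>\<sigma> c\<close>; the inverse of \<open>\<sigma>\<close> makes this a left action.
\<close>

definition wreath_sym :: "('g, 'm) monoid_scheme \<Rightarrow> 'c set \<Rightarrow> (('c \<Rightarrow> 'g) \<times> ('c \<Rightarrow> 'c)) monoid" where
  "wreath_sym G C =
     semidirect_product (product_group C (\<lambda>_. G)) (BijGroup C) (\<lambda>\<sigma> a. \<lambda>c\<in>C. a (inv_into C \<sigma> c))"

end

theory Submission
  imports Defs
begin

text \<open>
  Take the disjoint union of \<open>C i\<close> copies of each \<open>f i\<close>. Its automorphisms permute the connected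
  components, so if no \<open>f i\<close> is isomorphic to another \<open>f j\<close>, they permute for each \<open>i\<close> the copies
  of \<open>f i\<close> and act on each copy through \<open>Aut (f i)\<close>; that is an element of the product of the
  wreath products. The work lies in making the components pairwise non-isomorphic without changing
  their automorphism groups, and in doing so for as many indices as there are in \<open>I\<close>.

  To this end a rigid tree, depending only on \<open>i\<close>, is hung on every point of \<open>X i\<close>. Its nodes are
  the decreasing finite sequences of labels from an initial segment \<open>D i\<close> of a well-order: up to
  relabelling, the tree of an ordinal \<open>\<alpha>\<close>, whose root has exactly one child of each rank below \<open>\<alpha>\<close>.
  Whether a point has backward rank \<open>b\<close> (\<open>has_rank\<close>) is invariant under automorphisms
  (\<open>has_rank_automorphism\<close>). A tree node with newest label \<open>b\<close> has rank \<open>b\<close>, a label in \<open>D i\<close>, whereas a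
  point of \<open>X i\<close> has no rank in \<open>D i\<close> (\<open>rank_Cons\<close>, \<open>rank_Nil\<close>). So an automorphism that maps a
  component of type \<open>i\<close> to another one of type \<open>i\<close> maps original points to original points, and then it
  has no choice on the trees, since siblings have different ranks.

  Components of different types have to be told apart although the \<open>f i\<close> are arbitrary and may contain such
  trees themselves. The segments are therefore chosen so far apart that \<open>D i\<close> and \<open>D j\<close>
  differ by at least as many labels as \<open>X i\<close> and \<open>X j\<close> have subsets (\<open>ex_spread_segments\<close>). If,
  say, \<open>D i\<close> is the larger one, a component of type \<open>i\<close> contains points of all ranks in \<open>D i - D j\<close>,
  while in a component of type \<open>j\<close> only points of \<open>X j\<close> can have these ranks. By Cantor's theorem
  there are too few of them (\<open>no_large_gap\<close>).
\<close>

section \<open>Centralizers and ranks\<close>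

lemma carrier_fun_centralizer:
  assumes "f \<in> A \<rightarrow> A"
  shows "\<sigma> \<in> carrier (fun_centralizer A f) \<longleftrightarrow>
           \<sigma> \<in> extensional A \<and> bij_betw \<sigma> A A \<and> (\<forall>y\<in>A. \<sigma> (f y) = f (\<sigma> y))"
proof -
  have "compose A \<sigma> f = compose A f \<sigma> \<longleftrightarrow> (\<forall>y\<in>A. \<sigma> (f y) = f (\<sigma> y))"
    by (auto simp: compose_def restrict_def fun_eq_iff)
  then show ?thesis
    by (auto simp: fun_centralizer_def BijGroup_def Bij_def)
qed

lemma mult_fun_centralizer:
  assumes "\<sigma> \<in> carrier (fun_centralizer A f)" "\<tau> \<in> carrier (fun_centralizer A f)"
  shows "\<sigma> \<otimes>\<^bsub>fun_centralizer A f\<^esub> \<tau> = compose A \<sigma> \<tau>"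
  using assms by (simp add: fun_centralizer_def BijGroup_def)

lemma inv_into_commutes:
  assumes "bij_betw \<sigma> A A" "\<forall>y\<in>A. \<sigma> (f y) = f (\<sigma> y)" "f \<in> A \<rightarrow> A"
  shows "\<forall>y\<in>A. inv_into A \<sigma> (f y) = f (inv_into A \<sigma> y)"
proof
  fix y assume y: "y \<in> A"
  let ?z = "inv_into A \<sigma> y"
  have z: "?z \<in> A" "\<sigma> ?z = y"
    using assms(1) y by (auto simp: bij_betw_def inv_into_into f_inv_into_f)
  then have "f y = \<sigma> (f ?z)" using assms(2) by simp
  moreover have "f ?z \<in> A" using assms(3) z by auto
  ultimately show "inv_into A \<sigma> (f y) = f ?z"
    using assms(1) by (simp add: bij_betw_def)
qed

text \<open>
  A rank in the tree of iterated preimages, with elements of a well-order in place of ordinals. In contrast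
  to the usual rank, the ranks of the preimages of \<open>y\<close> have to exhaust the predecessors of \<open>b\<close>.
  This saves suprema, at the price that a point may have no rank even if its backward orbits are
  all finite; points with an infinite backward orbit never have one when \<open>r\<close> is well-founded.
\<close>

inductive has_rank :: "('l \<times> 'l) set \<Rightarrow> 'a set \<Rightarrow> ('a \<Rightarrow> 'a) \<Rightarrow> 'l \<Rightarrow> 'a \<Rightarrow> bool"
  for r A f where
  "y \<in> A \<Longrightarrow> \<forall>b'. (b', b) \<in> r \<longrightarrow> (\<exists>z\<in>A. f z = y \<and> has_rank r A f b' z) \<Longrightarrow>
   \<forall>z\<in>A. f z = y \<longrightarrow> (\<exists>b'. (b', b) \<in> r \<and> has_rank r A f b' z) \<Longrightarrow> has_rank r A f b y"

lemma has_rank_child: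
  "has_rank r A f b (f z) \<Longrightarrow> z \<in> A \<Longrightarrow> \<exists>b'. (b', b) \<in> r \<and> has_rank r A f b' z"
  by (blast elim: has_rank.cases)

lemma has_rank_unique:
  assumes "wf r" "total r" "has_rank r A f b y" "has_rank r A f b' y"
  shows "b = b'"
  using assms(3,4)
proof (induction arbitrary: b' rule: has_rank.induct)
  case (1 y b)
  have irr: "(a, a) \<notin> r" for a using assms(1) by simp
  have "(b', b) \<notin> r"
  proof
    assume lt: "(b', b) \<in> r"
    then obtain z where z: "z \<in> A" "f z = y" "\<And>b''. has_rank r A f b'' z \<Longrightarrow> b' = b''"
      using 1(2) by blast
    from 1(4) z(1,2) obtain b3 where "(b3, b') \<in> r" "has_rank r A f b3 z"
      using has_rank_child by metis
    then show False using z(3) irr by blast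
  qed
  moreover have "(b, b') \<notin> r"
  proof
    assume "(b, b') \<in> r"
    with 1(4) obtain z where z: "z \<in> A" "f z = y" "has_rank r A f b z"
      by (blast elim: has_rank.cases)
    then obtain b3 where "(b3, b) \<in> r" "\<And>b''. has_rank r A f b'' z \<Longrightarrow> b3 = b''"
      using 1(3) by blast
    then show False using z(3) irr by blast
  qed
  ultimately show ?case using assms(2) by (auto simp: total_on_def)
qed

lemma has_rank_automorphism:
  assumes "bij_betw \<sigma> A A" "\<forall>y\<in>A. \<sigma> (f y) = f (\<sigma> y)" "f \<in> A \<rightarrow> A" "has_rank r A f b y"
  shows "has_rank r A f b (\<sigma> y)"
  using assms(4)
proof (induction rule: has_rank.induct)
  case (1 y b)
  have sA: "\<sigma> z \<in> A" if "z \<in> A" for z using assms(1) that by (auto simp: bij_betw_def)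
  show ?case
  proof (intro has_rank.intros allI impI ballI)
    show "\<sigma> y \<in> A" using sA 1(1) .
  next
    fix b' assume "(b', b) \<in> r"
    then obtain z where "z \<in> A" "f z = y" "has_rank r A f b' (\<sigma> z)" using 1(2) by blast
    then show "\<exists>z\<in>A. f z = \<sigma> y \<and> has_rank r A f b' z"
      using assms(2) sA by (intro bexI[of _ "\<sigma> z"]) auto
  next
    fix z assume z: "z \<in> A" "f z = \<sigma> y"
    then obtain w where w: "w \<in> A" "z = \<sigma> w" using assms(1) by (auto simp: bij_betw_def)
    have "\<sigma> (f w) = \<sigma> y" "f w \<in> A" using w z assms(2,3) by auto
    then have "f w = y" using assms(1) 1(1) by (auto simp: bij_betw_def dest: inj_onD)
    then show "\<exists>b'. (b', b) \<in> r \<and> has_rank r A f b' z" using 1(3) w by blast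
  qed
qed

section \<open>Decorating a disjoint union of connected functions\<close>

text \<open>
  The assumption \<open>spread\<close> is the quantitative form of "far apart": between two of the initial
  segments there is room for more labels than \<open>'x\<close>, hence any \<open>X i\<close>, has elements.
\<close>
locale decorated_family =
  fixes r :: "('l \<times> 'l) set" and D :: "'i \<Rightarrow> 'l set" and I :: "'i set" and C :: "'i \<Rightarrow> 'c set"
    and X :: "'i \<Rightarrow> 'x set" and f :: "'i \<Rightarrow> 'x \<Rightarrow> 'x"
  assumes wf: "wf r" and trans: "trans r" and total: "total r"
    and down: "\<lbrakk>b \<in> D i; (b', b) \<in> r\<rbrakk> \<Longrightarrow> b' \<in> D i"
    and spread: "\<lbrakk>i \<in> I; j \<in> I; i \<noteq> j\<rbrakk> \<Longrightarrow>
      \<exists>e :: 'x set \<Rightarrow> 'l. inj e \<and> (range e \<subseteq> D i - D j \<or> range e \<subseteq> D j - D i)"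
    and nonempty: "i \<in> I \<Longrightarrow> X i \<noteq> {}"
    and connected: "i \<in> I \<Longrightarrow> connected_fun (X i) (f i)"
begin

text \<open>
  The nodes of the tree for \<open>i\<close>. A node is the list of labels met on the way to the root \<open>[]\<close>, the
  smallest label first, so that the parent of a node is its tail.
\<close>
definition paths :: "'i \<Rightarrow> 'l list set" where
  "paths i = {s. sorted_wrt (\<lambda>a b. (a, b) \<in> r) s \<and> set s \<subseteq> D i}"

text \<open>
  The point \<open>(i, c, x, s)\<close> is the node \<open>s\<close> of the tree on \<open>x\<close> in the copy number \<open>c\<close> of \<open>X i\<close>. The
  root \<open>s = []\<close> is \<open>x\<close> itself.
\<close>
definition A :: "('i \<times> 'c \<times> 'x \<times> 'l list) set" where
  "A = {(i, c, x, s). i \<in> I \<and> c \<in> C i \<and> x \<in> X i \<and> s \<in> paths i}"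

fun F :: "'i \<times> 'c \<times> 'x \<times> 'l list \<Rightarrow> 'i \<times> 'c \<times> 'x \<times> 'l list" where
  "F (i, c, x, []) = (i, c, f i x, [])"
| "F (i, c, x, b # s) = (i, c, x, s)"

abbreviation rank where "rank \<equiv> has_rank r A F"

lemmas rank_unique = has_rank_unique[OF wf total]

lemma Nil_paths [simp]: "[] \<in> paths i"
  by (simp add: paths_def)

lemma Cons_paths: "b # s \<in> paths i \<Longrightarrow> b \<in> D i \<and> s \<in> paths i"
  by (auto simp: paths_def)

lemma mem_A [simp]: "(i, c, x, s) \<in> A \<longleftrightarrow> i \<in> I \<and> c \<in> C i \<and> x \<in> X i \<and> s \<in> paths i"
  by (simp add: A_def)

lemma f_closed: "i \<in> I \<Longrightarrow> x \<in> X i \<Longrightarrow> f i x \<in> X i"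
  using connected by (auto simp: connected_fun_def)

lemma F_closed: "F \<in> A \<rightarrow> A"
proof
  fix y assume "y \<in> A"
  then show "F y \<in> A" by (cases y rule: F.cases) (auto simp: f_closed dest: Cons_paths)
qed

lemma F_preimage:
  assumes "F z = (i, c, x, s)"
  shows "(\<exists>b. z = (i, c, x, b # s)) \<or> s = [] \<and> (\<exists>x'. z = (i, c, x', []) \<and> f i x' = x)"
  using assms by (cases z rule: F.cases) auto

text \<open>The children of a node with newest label \<open>b\<close> carry each label below \<open>b\<close> exactly once.\<close>
lemma rank_Cons:
  assumes "(i, c, x, b # s) \<in> A"
  shows "rank b (i, c, x, b # s)"
  using assms
proof (induction b arbitrary: s rule: wf_induct_rule[OF wf])
  case (1 b)
  show ?case
  proof (intro has_rank.intros allI impI ballI)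
    fix b' assume b': "(b', b) \<in> r"
    have "b' # b # s \<in> paths i"
      using 1(2) b' down[of b i b'] transD[OF trans b'] by (auto simp: paths_def)
    then show "\<exists>z\<in>A. F z = (i, c, x, b # s) \<and> rank b' z"
      using 1 b' by (intro bexI[of _ "(i, c, x, b' # b # s)"]) auto
  next
    fix z assume z: "z \<in> A" "F z = (i, c, x, b # s)"
    then obtain b' where b': "z = (i, c, x, b' # b # s)" using F_preimage by blast
    then have "(b', b) \<in> r" using z by (auto simp: paths_def)
    then show "\<exists>b'. (b', b) \<in> r \<and> rank b' z" using 1(1) z b' by blast
  qed (use 1 in simp)
qed

text \<open>
  For \<open>b \<in> D i\<close> the root has a child of rank \<open>b\<close>, so it cannot have rank \<open>b\<close> as well.
\<close>
lemma rank_Nil: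
  assumes "(i, c, x, []) \<in> A" "rank b (i, c, x, [])"
  shows "b \<notin> D i"
proof
  assume "b \<in> D i"
  then have z: "(i, c, x, [b]) \<in> A" using assms(1) by (auto simp: paths_def)
  with assms(2) obtain b' where "(b', b) \<in> r" "rank b' (i, c, x, [b])"
    using has_rank_child[of r A F b "(i, c, x, [b])"] by auto
  then show False using rank_unique[OF rank_Cons[OF z]] wf_irrefl[OF wf] by metis
qed

lemma F_funpow_Nil: "(F ^^ m) (i, c, x, []) = (i, c, (f i ^^ m) x, [])"
  by (induction m) auto

lemma F_funpow_length: "(F ^^ length s) (i, c, x, s) = (i, c, x, [])"
  by (induction s) (auto simp: funpow_Suc_right simp del: funpow.simps)

lemma F_funpow_block: "\<exists>x' s'. (F ^^ m) (i, c, x, s) = (i, c, x', s')"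
proof (induction m)
  case (Suc m)
  then obtain x' s' where "(F ^^ m) (i, c, x, s) = (i, c, x', s')" by blast
  then show ?case by (cases s') auto
qed simp

text \<open>
  The orbit relation singles out the copies in terms of \<open>F\<close> alone, which is why automorphisms permute
  them. Points of one copy are related because every point reaches its root and \<open>f i\<close> is connected.
\<close>
lemma same_block_iff:
  assumes "(i, c, x, s) \<in> A" "(j, d, y, t) \<in> A"
  shows "(\<exists>m n. (F ^^ m) (i, c, x, s) = (F ^^ n) (j, d, y, t)) \<longleftrightarrow> i = j \<and> c = d"
proof
  assume "\<exists>m n. (F ^^ m) (i, c, x, s) = (F ^^ n) (j, d, y, t)"
  then show "i = j \<and> c = d" using F_funpow_block by (metis Pair_inject)
next
  assume eq: "i = j \<and> c = d"
  then obtain m n where mn: "(f i ^^ m) x = (f i ^^ n) y"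
    using connected[of i] assms unfolding connected_fun_def mem_A by metis
  have "(F ^^ (m + length s)) (i, c, x, s) = (F ^^ (n + length t)) (j, d, y, t)"
    using eq mn by (simp add: funpow_add F_funpow_length F_funpow_Nil)
  then show "\<exists>m n. (F ^^ m) (i, c, x, s) = (F ^^ n) (j, d, y, t)" by blast
qed

context
  fixes \<sigma>
  assumes bij: "bij_betw \<sigma> A A" and comm: "\<forall>y\<in>A. \<sigma> (F y) = F (\<sigma> y)"
begin

lemma \<sigma>_closed: "y \<in> A \<Longrightarrow> \<sigma> y \<in> A"
  using bij by (auto simp: bij_betw_def)

lemma \<sigma>_funpow: "y \<in> A \<Longrightarrow> (F ^^ m) y \<in> A \<and> \<sigma> ((F ^^ m) y) = (F ^^ m) (\<sigma> y)"
  by (induction m) (use comm F_closed in auto)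

lemma \<sigma>_block:
  assumes "(i, c, x, s) \<in> A" "(i, c, y, t) \<in> A"
    "\<sigma> (i, c, x, s) = (j, d, x', s')" "\<sigma> (i, c, y, t) = (k, e, y', t')"
  shows "j = k \<and> d = e"
proof -
  obtain m n where "(F ^^ m) (i, c, x, s) = (F ^^ n) (i, c, y, t)"
    using same_block_iff[OF assms(1,2)] by blast
  then have "(F ^^ m) (\<sigma> (i, c, x, s)) = (F ^^ n) (\<sigma> (i, c, y, t))"
    using \<sigma>_funpow assms(1,2) by metis
  then show ?thesis
    using same_block_iff \<sigma>_closed assms by metis
qed

lemma \<sigma>_rank: "rank b y \<Longrightarrow> rank b (\<sigma> y)"
  by (rule has_rank_automorphism[OF bij comm F_closed])

text \<open>
  Every label in \<open>range e\<close> is the rank of a node of the copy \<open>(i, c)\<close>. The image of that node in the copy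
  \<open>(j, d)\<close> has the same rank, which lies outside \<open>D j\<close>, so it is a root. Different labels give different
  roots, and \<open>'x set\<close> would inject into \<open>'x\<close>.
\<close>
lemma no_large_gap:
  fixes e :: "'x set \<Rightarrow> 'l"
  assumes "(i, c, x, s) \<in> A" "\<sigma> (i, c, x, s) = (j, d, x', s')" "inj e"
  shows "\<not> range e \<subseteq> D i - D j"
proof
  assume e: "range e \<subseteq> D i - D j"
  have "\<exists>y. \<sigma> (i, c, x, [e S]) = (j, d, y, [])" for S
  proof -
    have z: "(i, c, x, [e S]) \<in> A" using assms(1) e by (auto simp: paths_def)
    obtain j' d' y t where y: "\<sigma> (i, c, x, [e S]) = (j', d', y, t)" by (metis prod_cases4)
    have jd: "j' = j" "d' = d" using \<sigma>_block[OF assms(1) z assms(2) y] by auto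
    have rk: "rank (e S) (j, d, y, t)" using \<sigma>_rank[OF rank_Cons[OF z]] y jd by simp
    have im: "(j, d, y, t) \<in> A" using \<sigma>_closed[OF z] y jd by simp
    have "t = []"
    proof (cases t)
      case (Cons b t')
      then have "e S = b" using rank_unique[OF rk] rank_Cons im by metis
      then have "e S \<in> D j" using im Cons Cons_paths by auto
      then show ?thesis using e by blast
    qed
    then show ?thesis using y jd by simp
  qed
  then obtain g where g: "\<And>S. \<sigma> (i, c, x, [e S]) = (j, d, g S, [])" by metis
  have "inj g"
  proof (rule injI)
    fix S T assume "g S = g T"
    then have "\<sigma> (i, c, x, [e S]) = \<sigma> (i, c, x, [e T])" using g by simp
    moreover have "(i, c, x, [e S]) \<in> A" "(i, c, x, [e T]) \<in> A"
      using assms(1) e by (auto simp: paths_def)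
    ultimately have "(i, c, x, [e S]) = (i, c, x, [e T])"
      using bij unfolding bij_betw_def by (meson inj_onD)
    then have "e S = e T" by simp
    then show "S = T" using assms(3) by (simp add: inj_eq)
  qed
  then have "surj (inv_into UNIV g)" by (rule inj_imp_surj_inv)
  then show False using Cantors_theorem[of UNIV] by (metis Pow_UNIV)
qed

end

text \<open>
  Either \<open>D i\<close> or \<open>D j\<close> is the larger segment; in the second case \<open>no_large_gap\<close> applies to
  the inverse automorphism.
\<close>
lemma automorphism_index:
  assumes "bij_betw \<sigma> A A" "\<forall>y\<in>A. \<sigma> (F y) = F (\<sigma> y)"
    "(i, c, x, s) \<in> A" "\<sigma> (i, c, x, s) = (j, d, x', s')"
  shows "i = j"
proof (rule ccontr)
  assume "i \<noteq> j"
  let ?\<tau> = "inv_into A \<sigma>"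
  have im: "(j, d, x', s') \<in> A" using \<sigma>_closed[OF assms(1-3)] assms(4) by simp
  have \<tau>: "bij_betw ?\<tau> A A" "\<forall>y\<in>A. ?\<tau> (F y) = F (?\<tau> y)" "?\<tau> (j, d, x', s') = (i, c, x, s)"
    using bij_betw_inv_into[OF assms(1)] inv_into_commutes[OF assms(1,2) F_closed]
      bij_betw_inv_into_left[OF assms(1,3)] assms(4) by auto
  show False
    using spread[of i j] \<open>i \<noteq> j\<close> no_large_gap[OF assms] no_large_gap[OF \<tau>(1,2) im \<tau>(3)] assms(3) im
    by auto
qed

text \<open>If the image of a root were a proper tree node, the root would have a rank in \<open>D i\<close>.\<close>
lemma automorphism_Nil:
  assumes "bij_betw \<sigma> A A" "\<forall>y\<in>A. \<sigma> (F y) = F (\<sigma> y)" "(i, c, x, []) \<in> A"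
  shows "\<exists>d x'. \<sigma> (i, c, x, []) = (i, d, x', [])"
proof -
  obtain j d x' t where eq: "\<sigma> (i, c, x, []) = (j, d, x', t)" by (metis prod_cases4)
  then have [simp]: "j = i" using automorphism_index[OF assms(1-3)] by metis
  have im: "(i, d, x', t) \<in> A" using \<sigma>_closed[OF assms] eq by simp
  have "t = []"
  proof (cases t)
    case (Cons b t')
    have "rank b (inv_into A \<sigma> (i, d, x', t))"
      using has_rank_automorphism[OF bij_betw_inv_into[OF assms(1)]
          inv_into_commutes[OF assms(1,2) F_closed] F_closed]
        rank_Cons[of i d x' b t'] im Cons by simp
    then have "rank b (i, c, x, [])"
      using bij_betw_inv_into_left[OF assms(1,3)] eq by simp
    then show ?thesis using rank_Nil[OF assms(3)] im Cons Cons_paths by auto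
  qed
  then show ?thesis using eq by simp
qed

text \<open>
  The trees are rigid: once the root is placed, each node goes to a preimage of the image of its parent,
  and its rank leaves only one candidate, as the preimages that are roots have no rank in \<open>D i\<close>.
\<close>
lemma automorphism_fixes_path:
  assumes "bij_betw \<sigma> A A" "\<forall>y\<in>A. \<sigma> (F y) = F (\<sigma> y)" "(i, c, x, s) \<in> A"
    "\<sigma> (i, c, x, []) = (i, d, x', [])"
  shows "\<sigma> (i, c, x, s) = (i, d, x', s)"
  using assms(3)
proof (induction s)
  case (Cons b s)
  have bs: "(i, c, x, s) \<in> A" "b \<in> D i" using Cons.prems Cons_paths by auto
  have im: "\<sigma> (i, c, x, b # s) \<in> A" using \<sigma>_closed[OF assms(1,2) Cons.prems] .
  have rk: "rank b (\<sigma> (i, c, x, b # s))" using \<sigma>_rank[OF assms(1,2)] rank_Cons Cons.prems by blast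
  have "F (\<sigma> (i, c, x, b # s)) = (i, d, x', s)"
    using assms(2) Cons.prems Cons.IH[OF bs(1)] by (metis F.simps(2))
  from F_preimage[OF this] show ?case
  proof (elim disjE exE conjE)
    fix b' assume eq: "\<sigma> (i, c, x, b # s) = (i, d, x', b' # s)"
    then have "b = b'" using rank_unique[OF rk] rank_Cons im by metis
    then show ?thesis using eq by simp
  next
    fix y assume "\<sigma> (i, c, x, b # s) = (i, d, y, [])"
    then show ?thesis using rank_Nil rk im bs by metis
  qed
qed (use assms in simp)

lemma automorphism_form:
  assumes "bij_betw \<sigma> A A" "\<forall>y\<in>A. \<sigma> (F y) = F (\<sigma> y)"
  obtains p a where
    "\<And>i c x s. (i, c, x, s) \<in> A \<Longrightarrow> \<sigma> (i, c, x, s) = (i, p i c, a i c x, s)"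
proof -
  \<comment> \<open>The copy that receives \<open>(i, c)\<close> is read off at an arbitrary point of \<open>X i\<close>.\<close>
  define u where "u i = (SOME x. x \<in> X i)" for i
  have u: "u i \<in> X i" if "i \<in> I" for i using nonempty[OF that] by (simp add: u_def some_in_eq)
  define p where "p i c = fst (snd (\<sigma> (i, c, u i, [])))" for i c
  define a where "a i c x = fst (snd (snd (\<sigma> (i, c, x, []))))" for i c x
  show ?thesis
  proof (rule that)
    fix i c x s assume y: "(i, c, x, s) \<in> A"
    then have y0: "(i, c, x, []) \<in> A" and yu: "(i, c, u i, []) \<in> A" using u by auto
    obtain d x' where d: "\<sigma> (i, c, x, []) = (i, d, x', [])"
      using automorphism_Nil[OF assms y0] by blast
    obtain d' x'' where d': "\<sigma> (i, c, u i, []) = (i, d', x'', [])"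
      using automorphism_Nil[OF assms yu] by blast
    have "d = d'" using \<sigma>_block[OF assms y0 yu d d'] by simp
    then show "\<sigma> (i, c, x, s) = (i, p i c, a i c x, s)"
      using automorphism_fixes_path[OF assms y d] d d' by (simp add: p_def a_def)
  qed
qed

lemma automorphism_components:
  assumes "bij_betw \<sigma> A A" "\<forall>y\<in>A. \<sigma> (F y) = F (\<sigma> y)"
  obtains p a where
    "\<And>i c x s. (i, c, x, s) \<in> A \<Longrightarrow> \<sigma> (i, c, x, s) = (i, p i c, a i c x, s)"
    "\<And>i. i \<in> I \<Longrightarrow> bij_betw (p i) (C i) (C i)"
    "\<And>i c. i \<in> I \<Longrightarrow> c \<in> C i \<Longrightarrow> bij_betw (a i c) (X i) (X i)"
    "\<And>i c x. i \<in> I \<Longrightarrow> c \<in> C i \<Longrightarrow> x \<in> X i \<Longrightarrow> a i c (f i x) = f i (a i c x)"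
proof -
  \<comment> \<open>The inverse has the same form; its data \<open>q\<close> and \<open>b\<close> invert \<open>p\<close> and \<open>a\<close>.\<close>
  let ?\<tau> = "inv_into A \<sigma>"
  have bij': "bij_betw ?\<tau> A A" and comm': "\<forall>y\<in>A. ?\<tau> (F y) = F (?\<tau> y)"
    using bij_betw_inv_into[OF assms(1)] inv_into_commutes[OF assms F_closed] by auto
  obtain p a where pa: "\<And>i c x s. (i, c, x, s) \<in> A \<Longrightarrow> \<sigma> (i, c, x, s) = (i, p i c, a i c x, s)"
    using automorphism_form[OF assms] by blast
  obtain q b where qb: "\<And>i c x s. (i, c, x, s) \<in> A \<Longrightarrow> ?\<tau> (i, c, x, s) = (i, q i c, b i c x, s)"
    using automorphism_form[OF bij' comm'] by blast
  have cl: "p i c \<in> C i \<and> a i c x \<in> X i \<and> q i c \<in> C i \<and> b i c x \<in> X i"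
    if "i \<in> I" "c \<in> C i" "x \<in> X i" for i c x
    using \<sigma>_closed[OF assms, of "(i, c, x, [])"] \<sigma>_closed[OF bij' comm', of "(i, c, x, [])"]
      pa[of i c x "[]"] qb[of i c x "[]"] that by auto
  have inv: "q i (p i c) = c \<and> b i (p i c) (a i c x) = x \<and> p i (q i c) = c \<and> a i (q i c) (b i c x) = x"
    if "i \<in> I" "c \<in> C i" "x \<in> X i" for i c x
  proof -
    have y: "(i, c, x, []) \<in> A" using that by simp
    have "?\<tau> (\<sigma> (i, c, x, [])) = (i, c, x, [])" "\<sigma> (?\<tau> (i, c, x, [])) = (i, c, x, [])"
      using bij_betw_inv_into_left[OF assms(1) y] bij_betw_inv_into_right[OF assms(1) y] by auto
    then show ?thesis using that cl[OF that] by (auto simp: pa qb)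
  qed
  show ?thesis
  proof (rule that)
    show "\<sigma> (i, c, x, s) = (i, p i c, a i c x, s)" if "(i, c, x, s) \<in> A" for i c x s
      using pa that .
  next
    fix i assume i: "i \<in> I"
    then obtain x where "x \<in> X i" using nonempty by blast
    then show "bij_betw (p i) (C i) (C i)"
      by (intro bij_betw_byWitness[where f' = "q i"]) (use inv[OF i] cl[OF i] in auto)
  next
    fix i c assume ic: "i \<in> I" "c \<in> C i"
    then obtain x0 where x0: "x0 \<in> X i" using nonempty by blast
    have qp: "q i (p i c) = c" and "p i c \<in> C i" using inv[OF ic x0] cl[OF ic x0] by auto
    then show "bij_betw (a i c) (X i) (X i)"
      using inv[of i c] inv[of i "p i c"] cl[of i c] cl[of i "p i c"] ic
      by (intro bij_betw_byWitness[where f' = "b i (p i c)"]) auto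
  next
    fix i c x assume "i \<in> I" "c \<in> C i" "x \<in> X i"
    then show "a i c (f i x) = f i (a i c x)"
      using assms(2)[rule_format, of "(i, c, x, [])"] f_closed by (auto simp: pa)
  qed
qed

end

section \<open>The isomorphism\<close>

locale decorated_representation = decorated_family r D I C X f
  for r :: "('l \<times> 'l) set" and D :: "'i \<Rightarrow> 'l set" and I and C :: "'i \<Rightarrow> 'c set"
    and X :: "'i \<Rightarrow> 'x set" and f +
  fixes G :: "'i \<Rightarrow> ('g, 'm) monoid_scheme" and h :: "'i \<Rightarrow> 'g \<Rightarrow> 'x \<Rightarrow> 'x"
  assumes iso: "i \<in> I \<Longrightarrow> h i \<in> iso (G i) (fun_centralizer (X i) (f i))"
begin

text \<open>
  The entry of a wreath product element that acts on the copy \<open>c\<close> is the one at the target position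
  \<open>\<sigma> c\<close>. This matches the multiplication of \<open>wreath_sym\<close>: in \<open>(a, \<sigma>) (b, \<tau>)\<close> the entry at
  \<open>\<sigma> (\<tau> c)\<close> is the product of \<open>a (\<sigma> (\<tau> c))\<close> and \<open>b (\<tau> c)\<close>.
\<close>

definition act :: "('i \<Rightarrow> ('c \<Rightarrow> 'g) \<times> ('c \<Rightarrow> 'c)) \<Rightarrow>
    'i \<times> 'c \<times> 'x \<times> 'l list \<Rightarrow> 'i \<times> 'c \<times> 'x \<times> 'l list" where
  "act w = (\<lambda>(i, c, x, s)\<in>A. (i, snd (w i) c, h i (fst (w i) (snd (w i) c)) x, s))"

definition W where "W = product_group I (\<lambda>i. wreath_sym (G i) (C i))"

lemma act_apply: "(i, c, x, s) \<in> A \<Longrightarrow>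
    act w (i, c, x, s) = (i, snd (w i) c, h i (fst (w i) (snd (w i) c)) x, s)"
  by (simp add: act_def)

lemma carrier_W: "w \<in> carrier W \<longleftrightarrow> w \<in> extensional I \<and>
    (\<forall>i\<in>I. fst (w i) \<in> (\<Pi>\<^sub>E c\<in>C i. carrier (G i)) \<and> snd (w i) \<in> extensional (C i)
      \<and> bij_betw (snd (w i)) (C i) (C i))"
  by (auto simp: W_def wreath_sym_def semidirect_product_def BijGroup_def Bij_def PiE_iff mem_Times_iff)

lemma h_carrier:
  assumes "i \<in> I" "g \<in> carrier (G i)"
  shows "h i g \<in> carrier (fun_centralizer (X i) (f i))"
  using iso[OF assms(1)] assms(2) by (auto simp: iso_def hom_def)

lemma h_props:
  assumes "i \<in> I" "g \<in> carrier (G i)"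
  shows "h i g \<in> extensional (X i)" "bij_betw (h i g) (X i) (X i)"
    "x \<in> X i \<Longrightarrow> h i g (f i x) = f i (h i g x)"
proof -
  have "f i \<in> X i \<rightarrow> X i" using f_closed[OF assms(1)] by auto
  from carrier_fun_centralizer[OF this] h_carrier[OF assms]
  show "h i g \<in> extensional (X i)" "bij_betw (h i g) (X i) (X i)"
    "x \<in> X i \<Longrightarrow> h i g (f i x) = f i (h i g x)" by blast+
qed

lemma W_props:
  assumes "w \<in> carrier W" "i \<in> I" "c \<in> C i"
  shows "snd (w i) c \<in> C i" "fst (w i) c \<in> carrier (G i)"
  using assms by (auto simp: carrier_W bij_betw_def)

lemma W_bij: "w \<in> carrier W \<Longrightarrow> i \<in> I \<Longrightarrow> bij_betw (snd (w i)) (C i) (C i)"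
  by (simp add: carrier_W)

lemma act_closed:
  assumes "w \<in> carrier W"
  shows "act w \<in> carrier (fun_centralizer A F)"
proof -
  have hin: "h i (fst (w i) c) x \<in> X i" if "i \<in> I" "c \<in> C i" "x \<in> X i" for i c x
    using bij_betw_apply[OF h_props(2)[OF that(1) W_props(2)[OF assms that(1,2)]] that(3)] .
  have cl: "act w y \<in> A" if "y \<in> A" for y
    using that W_props[OF assms] by (cases y) (auto simp: act_apply intro!: hin)
  have "inj_on (act w) A"
  proof (rule inj_onI)
    fix y z assume yz: "y \<in> A" "z \<in> A" "act w y = act w z"
    obtain i c x s where y: "y = (i, c, x, s)" by (metis prod_cases4)
    obtain j d x' t where z: "z = (j, d, x', t)" by (metis prod_cases4)
    have [simp]: "j = i" "t = s" and i: "i \<in> I" "c \<in> C i" "d \<in> C i" "x \<in> X i" "x' \<in> X i"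
      and e: "snd (w i) c = snd (w i) d"
      "h i (fst (w i) (snd (w i) c)) x = h i (fst (w i) (snd (w i) d)) x'"
      using yz by (auto simp: y z act_apply)
    have "c = d" using e(1) i assms by (auto simp: carrier_W bij_betw_def inj_on_def)
    moreover have "inj_on (h i (fst (w i) (snd (w i) c))) (X i)"
      using h_props(2) W_props[OF assms] i by (auto simp: bij_betw_def)
    ultimately show "y = z" using e(2) i by (auto simp: y z inj_on_def)
  qed
  moreover have "y \<in> act w ` A" if "y \<in> A" for y
  proof -
    obtain i c x s where y: "y = (i, c, x, s)" by (metis prod_cases4)
    then have i: "i \<in> I" "c \<in> C i" "x \<in> X i" "s \<in> paths i" using that by auto
    obtain d where d: "d \<in> C i" "snd (w i) d = c"
      using W_bij[OF assms i(1)] i(2) unfolding bij_betw_def by (metis imageE)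
    obtain x' where x': "x' \<in> X i" "h i (fst (w i) c) x' = x"
      using h_props(2)[OF i(1) W_props(2)[OF assms i(1,2)]] i(3)
      unfolding bij_betw_def by (metis imageE)
    have "y = act w (i, d, x', s)" using i d x' y by (simp add: act_apply)
    then show ?thesis using i d x' by (auto intro!: image_eqI)
  qed
  ultimately have bij: "bij_betw (act w) A A" using cl by (auto simp: bij_betw_def)
  have comm: "act w (F y) = F (act w y)" if "y \<in> A" for y
    using that F_closed h_props(3) W_props[OF assms]
    by (cases y rule: F.cases) (auto simp: act_apply f_closed dest!: Cons_paths)
  show ?thesis
    unfolding carrier_fun_centralizer[OF F_closed] using bij comm by (auto simp: act_def)
qed

lemma W_mult:
  assumes "v \<in> carrier W" "w \<in> carrier W" "i \<in> I"
  shows "snd ((v \<otimes>\<^bsub>W\<^esub> w) i) = compose (C i) (snd (v i)) (snd (w i))"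
    and "fst ((v \<otimes>\<^bsub>W\<^esub> w) i) =
      (\<lambda>c\<in>C i. fst (v i) c \<otimes>\<^bsub>G i\<^esub> (\<lambda>c\<in>C i. fst (w i) (inv_into (C i) (snd (v i)) c)) c)"
  using assms unfolding carrier_W
  by (auto simp: W_def wreath_sym_def semidirect_product_def BijGroup_def Bij_def split_beta)

lemma act_mult:
  assumes v: "v \<in> carrier W" and w: "w \<in> carrier W"
  shows "act (v \<otimes>\<^bsub>W\<^esub> w) = compose A (act v) (act w)"
proof (rule extensionalityI[of _ A])
  fix y assume "y \<in> A"
  obtain i c x s where y: "y = (i, c, x, s)" by (metis prod_cases4)
  then have i: "i \<in> I" "c \<in> C i" "x \<in> X i" "s \<in> paths i" using \<open>y \<in> A\<close> by auto
  let ?d = "snd (w i) c" and ?e = "snd (v i) (snd (w i) c)"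
  have d: "?d \<in> C i" "?e \<in> C i" using W_props(1) v w i by blast+
  have gs: "fst (v i) ?e \<in> carrier (G i)" "fst (w i) ?d \<in> carrier (G i)"
    using W_props(2) v w i d by blast+
  have inv: "inv_into (C i) (snd (v i)) ?e = ?d"
    using bij_betw_inv_into_left[OF W_bij[OF v i(1)] d(1)] .
  have hx: "h i (fst (w i) ?d) x \<in> X i"
    using h_props(2)[OF i(1) gs(2)] i(3) by (auto simp: bij_betw_def)
  have "h i (fst (v i) ?e \<otimes>\<^bsub>G i\<^esub> fst (w i) ?d)
      = compose (X i) (h i (fst (v i) ?e)) (h i (fst (w i) ?d))"
    using iso[OF i(1)] gs h_carrier[OF i(1)] by (auto simp: iso_def hom_def mult_fun_centralizer)
  then have hm: "h i (fst (v i) ?e \<otimes>\<^bsub>G i\<^esub> fst (w i) ?d) x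
      = h i (fst (v i) ?e) (h i (fst (w i) ?d) x)"
    using i by (simp add: compose_eq)
  show "act (v \<otimes>\<^bsub>W\<^esub> w) y = compose A (act v) (act w) y"
    using i d hx hm inv
    by (simp add: y compose_eq act_apply W_mult[OF v w i(1)])
qed (auto simp: act_def compose_def)

lemma act_inj: "inj_on act (carrier W)"
proof (rule inj_onI)
  fix v w assume v: "v \<in> carrier W" and w: "w \<in> carrier W" and eq: "act v = act w"
  have "v i = w i" if i: "i \<in> I" for i
  proof -
    have E: "snd (v i) c = snd (w i) c \<and>
        h i (fst (v i) (snd (w i) c)) x = h i (fst (w i) (snd (w i) c)) x"
      if "c \<in> C i" "x \<in> X i" for c x
      using fun_cong[OF eq, of "(i, c, x, [])"] i that by (auto simp: act_apply)
    obtain x0 where x0: "x0 \<in> X i" using nonempty i by blast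
    have s: "snd (v i) = snd (w i)"
    proof (rule extensionalityI[of _ "C i"])
      show "snd (v i) \<in> extensional (C i)" "snd (w i) \<in> extensional (C i)"
        using v w i by (auto simp: carrier_W)
    qed (use E x0 in blast)
    have "fst (v i) = fst (w i)"
    proof (rule extensionalityI[of _ "C i"])
      show "fst (v i) \<in> extensional (C i)" "fst (w i) \<in> extensional (C i)"
        using v w i by (auto simp: carrier_W PiE_iff)
    next
      fix d assume d: "d \<in> C i"
      then obtain c where c: "c \<in> C i" "snd (w i) c = d"
        using W_bij[OF w i] unfolding bij_betw_def by (metis imageE)
      have g: "fst (v i) d \<in> carrier (G i)" "fst (w i) d \<in> carrier (G i)"
        using W_props v w i d by blast+
      have "h i (fst (v i) d) = h i (fst (w i) d)"
      proof (rule extensionalityI[of _ "X i"])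
        fix x assume "x \<in> X i"
        then show "h i (fst (v i) d) x = h i (fst (w i) d) x" using E[OF c(1)] c s by auto
      qed (use h_props(1)[OF i] g in auto)
      then show "fst (v i) d = fst (w i) d"
        using iso[OF i] g by (auto simp: iso_def bij_betw_def inj_on_def)
    qed
    with s show ?thesis by (simp add: prod_eq_iff)
  qed
  then show "v = w"
    using v w by (intro extensionalityI[of _ I]) (auto simp: carrier_W)
qed

text \<open>This is where the classification of the automorphisms of \<open>F\<close> is used.\<close>
lemma act_surj:
  assumes "\<sigma> \<in> carrier (fun_centralizer A F)"
  shows "\<sigma> \<in> act ` carrier W"
proof -
  have \<sigma>: "\<sigma> \<in> extensional A" "bij_betw \<sigma> A A" "\<forall>y\<in>A. \<sigma> (F y) = F (\<sigma> y)"
    using assms carrier_fun_centralizer[OF F_closed] by auto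
  obtain p a where
    form: "\<And>i c x s. (i, c, x, s) \<in> A \<Longrightarrow> \<sigma> (i, c, x, s) = (i, p i c, a i c x, s)"
    and p: "\<And>i. i \<in> I \<Longrightarrow> bij_betw (p i) (C i) (C i)"
    and a: "\<And>i c. i \<in> I \<Longrightarrow> c \<in> C i \<Longrightarrow> bij_betw (a i c) (X i) (X i)"
    and af: "\<And>i c x. i \<in> I \<Longrightarrow> c \<in> C i \<Longrightarrow> x \<in> X i \<Longrightarrow> a i c (f i x) = f i (a i c x)"
    using automorphism_components[OF \<sigma>(2,3)] by blast
  have "\<exists>g\<in>carrier (G i). h i g = restrict (a i c) (X i)" if ic: "i \<in> I" "c \<in> C i" for i c
  proof -
    have fi: "f i \<in> X i \<rightarrow> X i" using f_closed ic by auto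
    have "restrict (a i c) (X i) \<in> carrier (fun_centralizer (X i) (f i))"
      unfolding carrier_fun_centralizer[OF fi] using a[OF ic] af[OF ic] f_closed ic
      by (auto cong: bij_betw_cong)
    then have "restrict (a i c) (X i) \<in> h i ` carrier (G i)"
      using iso[OF ic(1)] by (simp add: iso_def bij_betw_def)
    then show ?thesis by force
  qed
  then obtain g where g: "\<And>i c. i \<in> I \<Longrightarrow> c \<in> C i \<Longrightarrow>
      g i c \<in> carrier (G i) \<and> h i (g i c) = restrict (a i c) (X i)" by metis
  \<comment> \<open>\<open>a i c\<close> belongs at the target position \<open>p i c\<close>, so the entry at \<open>c\<close> comes from the preimage of \<open>c\<close>.\<close>
  define w where "w = (\<lambda>i\<in>I. (\<lambda>c\<in>C i. g i (inv_into (C i) (p i) c), restrict (p i) (C i)))"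
  have q: "inv_into (C i) (p i) c \<in> C i" if "i \<in> I" "c \<in> C i" for i c
    using p that by (auto simp: bij_betw_def inv_into_into)
  have w: "w \<in> carrier W"
    using p q g by (auto simp: carrier_W w_def cong: bij_betw_cong)
  have "\<sigma> = act w"
  proof (rule extensionalityI[of _ A])
    fix y assume "y \<in> A"
    obtain i c x s where y: "y = (i, c, x, s)" by (metis prod_cases4)
    then have i: "i \<in> I" "c \<in> C i" "x \<in> X i" "s \<in> paths i" using \<open>y \<in> A\<close> by auto
    have "p i c \<in> C i" "inv_into (C i) (p i) (p i c) = c"
      using p[OF i(1)] i(2) by (auto simp: bij_betw_def)
    then show "\<sigma> y = act w y"
      using i g[OF i(1,2)] by (simp add: y form act_apply w_def)
  qed (use \<sigma> in \<open>auto simp: act_def\<close>)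
  with w show ?thesis by blast
qed

theorem product_wreath_iso: "W \<cong> fun_centralizer A F"
proof -
  have "act \<in> hom W (fun_centralizer A F)"
    using act_closed act_mult by (auto simp: hom_def mult_fun_centralizer)
  moreover have "bij_betw act (carrier W) (carrier (fun_centralizer A F))"
    using act_inj act_closed act_surj by (auto simp: bij_betw_def)
  ultimately show ?thesis by (auto simp: is_iso_def iso_def)
qed

end

section \<open>Widely spread initial segments\<close>

lemma ex_wf_trans_total: "\<exists>r :: ('a \<times> 'a) set. wf r \<and> trans r \<and> total r"
proof -
  obtain s :: "('a \<times> 'a) set" where s: "well_order_on UNIV s"
    using well_order_on by blast
  then have "wf (s - Id)" "trans (s - Id)" "total (s - Id)"
    by (auto simp: well_order_on_def linear_order_on_def partial_order_on_def preorder_on_def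
        intro: trans_diff_Id)
  then show ?thesis by blast
qed

text \<open>
  Sort the sets first by a key in \<open>'i\<close> and then by a well-order of their own, and let \<open>D i\<close> consist of
  the sets with key below \<open>i\<close>. For \<open>i\<close> below \<open>j\<close>, all sets with key \<open>i\<close> lie in \<open>D j - D i\<close>, and
  these include a copy of every subset of \<open>'x\<close>.
\<close>
lemma ex_spread_segments:
  "\<exists>(r :: (('i + 'x + 'n) set \<times> ('i + 'x + 'n) set) set) (D :: 'i \<Rightarrow> ('i + 'x + 'n) set set).
     wf r \<and> trans r \<and> total r \<and> (\<forall>i b b'. b \<in> D i \<longrightarrow> (b', b) \<in> r \<longrightarrow> b' \<in> D i) \<and>
     (\<forall>i j. i \<noteq> j \<longrightarrow> (\<exists>e :: 'x set \<Rightarrow> ('i + 'x + 'n) set.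
        inj e \<and> (range e \<subseteq> D i - D j \<or> range e \<subseteq> D j - D i)))"
proof -
  obtain p :: "('i \<times> 'i) set" where p: "wf p" "trans p" "total p"
    using ex_wf_trans_total by blast
  obtain q :: "(('i + 'x + 'n) set \<times> ('i + 'x + 'n) set) set" where q: "wf q" "trans q" "total q"
    using ex_wf_trans_total by blast
  \<comment> \<open>Sets that do not contain exactly one index get an unspecified key: \<open>r\<close> is a strict
    well-order with initial segments \<open>D i\<close> whatever the keys are.\<close>
  define key where "key b = (THE i. Inl i \<in> b)" for b :: "('i + 'x + 'n) set"
  define r where "r = inv_image (p <*lex*> q) (\<lambda>b. (key b, b))"
  define D where "D i = {b. (key b, i) \<in> p}" for i
  define e :: "'i \<Rightarrow> 'x set \<Rightarrow> ('i + 'x + 'n) set"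
    where "e i S = insert (Inl i) (Inr ` Inl ` S)" for i S
  have key_e: "key (e i S) = i" for i S by (auto simp: key_def e_def)
  have inj_e: "inj (e i)" for i
  proof (rule injI)
    fix S T assume "e i S = e i T"
    then have "{x. Inr (Inl x) \<in> e i S} = {x. Inr (Inl x) \<in> e i T}" by simp
    then show "S = T" by (auto simp: e_def)
  qed
  have gap: "range (e i) \<subseteq> D j - D i" if "(i, j) \<in> p" for i j
    using that p(1) by (auto simp: D_def key_e)
  have "wf r" unfolding r_def using p q by auto
  moreover have "trans r"
    using p(2) q(2) unfolding trans_def r_def in_inv_image in_lex_prod by metis
  moreover have "total r"
    unfolding total_on_def
  proof (intro ballI impI)
    fix b b' :: "('i + 'x + 'n) set" assume "b \<noteq> b'"
    then have "(b, b') \<in> q \<or> (b', b) \<in> q" using q(3) by (simp add: total_on_def)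
    moreover have "key b = key b' \<or> (key b, key b') \<in> p \<or> (key b', key b) \<in> p"
      using p(3) unfolding total_on_def by blast
    ultimately show "(b, b') \<in> r \<or> (b', b) \<in> r" by (auto simp: r_def in_inv_image)
  qed
  moreover have "\<forall>i b b'. b \<in> D i \<longrightarrow> (b', b) \<in> r \<longrightarrow> b' \<in> D i"
    using p(2) by (auto simp: r_def D_def in_inv_image dest: transD)
  moreover have "\<forall>i j. i \<noteq> j \<longrightarrow> (\<exists>e :: 'x set \<Rightarrow> ('i + 'x + 'n) set.
        inj e \<and> (range e \<subseteq> D i - D j \<or> range e \<subseteq> D j - D i))"
    using p(3) inj_e gap by (metis UNIV_I total_on_def)
  ultimately show ?thesis by blast
qed

section \<open>Products of wreath products are centralizers\<close>

theorem theorem4p11: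
  fixes I :: "'i set"
    and G :: "'i \<Rightarrow> ('g, 'm) monoid_scheme"
    and C :: "'i \<Rightarrow> 'c set"
  assumes "I \<noteq> {}"
    and "\<And>i. i \<in> I \<Longrightarrow> C i \<noteq> {}"
    and "\<And>i. i \<in> I \<Longrightarrow> group (G i)"
    and "\<And>i. i \<in> I \<Longrightarrow>
           \<exists>(A :: 'x set) f. A \<noteq> {} \<and> connected_fun A f \<and> G i \<cong> fun_centralizer A f"
  shows "\<exists>(A :: ('i \<times> 'c \<times> 'x \<times> ('i + 'x + nat) set list) set) f.
           A \<noteq> {} \<and> f \<in> A \<rightarrow> A \<and>
           product_group I (\<lambda>i. wreath_sym (G i) (C i)) \<cong> fun_centralizer A f"
proof -
  have "\<forall>i\<in>I. \<exists>(A :: 'x set) f h. A \<noteq> {} \<and> connected_fun A f \<and> h \<in> iso (G i) (fun_centralizer A f)"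
    using assms(4) unfolding is_iso_def by blast
  then obtain X :: "'i \<Rightarrow> 'x set" and f h where Xfh: "\<And>i. i \<in> I \<Longrightarrow>
      X i \<noteq> {} \<and> connected_fun (X i) (f i) \<and> h i \<in> iso (G i) (fun_centralizer (X i) (f i))"
    by metis
  obtain r :: "(('i + 'x + nat) set \<times> ('i + 'x + nat) set) set" and D :: "'i \<Rightarrow> _"
    where rD: "wf r" "trans r" "total r" "\<And>i b b'. b \<in> D i \<Longrightarrow> (b', b) \<in> r \<Longrightarrow> b' \<in> D i"
      "\<And>i j. i \<noteq> j \<Longrightarrow> \<exists>e :: 'x set \<Rightarrow> ('i + 'x + nat) set.
        inj e \<and> (range e \<subseteq> D i - D j \<or> range e \<subseteq> D j - D i)"
    using ex_spread_segments by metis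
  interpret decorated_representation r D I C X f G h
    by unfold_locales (use rD Xfh in blast)+
  obtain i c x where "i \<in> I" "c \<in> C i" "x \<in> X i" using assms(1,2) Xfh by blast
  then have "(i, c, x, []) \<in> A" by simp
  then show ?thesis using F_closed product_wreath_iso unfolding W_def by blast
qed

end
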